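(* Let $(H;(\cdot,\cdot))$ be an inner product space over $\mathbb{K}$, where $\mathbb{K}=\mathbb{R}$ or $\mathbb{K}=\mathbb{C}$, let $n\ge 1$, let $x,y_1,\dots,y_n\in H$ and $c_1,\dots,c_n\in\mathbb{K}$. Then each of the following four inequalities holds: (i) $$\Big|\sum_{i=1}^n c_i(x,y_i)\Big|^2\le\|x\|^2\sum_{i=1}^n|c_i|^2\Big\{\max_{1\le i\le n}\|y_i\|^2+\Big(\sum_{1\le i\ne j\le n}|(y_i,y_j)|^2\Big)^{\frac12}\Big\};$$ (ii) $$\Big|\sum_{i=1}^n c_i(x,y_i)\Big|^2\le\|x\|^2\max_{1\le i\le n}|c_i|^2\Big\{\sum_{i=1}^n\|y_i\|^2+\sum_{1\le i\ne j\le n}|(y_i,y_j)|\Big\};$$ (iii) for all real $p>1$ and $q$ with $\frac1p+\frac1q=1$, $$\Big|\sum_{i=1}^n c_i(x,y_i)\Big|^2\le\|x\|^2\Big(\sum_{i=1}^n|c_i|^{2p}\Big)^{\frac1p}\Big\{\Big(\sum_{i=1}^n\|y_i\|^{2q}\Big)^{\frac1q}+(n-1)^{\frac1p}\Big(\sum_{1\le i\ne j\le n}|(y_i,y_j)|^q\Big)^{\frac1q}\Big\};$$ (iv) $$\Big|\sum_{i=1}^n c_i(x,y_i)\Big|^2\le\|x\|^2\sum_{i=1}^n|c_i|^2\Big\{\max_{1\le i\le n}\|y_i\|^2+(n-1)\max_{1\le i\ne j\le n}|(y_i,y_j)|\Big\}.$$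
   Context: The inner product is linear in the first argument and conjugate-linear in the second, and $\|v\|=(v,v)^{1/2}$. Sums and maxima over $1\le i\ne j\le n$ range over all ordered pairs $(i,j)\in\{1,\dots,n\}^2$ with $i\neq j$; for $n=1$ such (empty) sums and maxima are read as $0$. *)

theory Defs
  imports "HOL-Analysis.Analysis"
begin

(* The types of this class are the copies of the real field and of the complex field: to_complex
   is an isometric field embedding whose image is the set of reals or all of the complex numbers. *)
class real_or_complex = real_normed_field +
  fixes to_complex :: "'a \<Rightarrow> complex"
  assumes to_complex_add: "to_complex (a + b) = to_complex a + to_complex b"
    and to_complex_mult: "to_complex (a * b) = to_complex a * to_complex b"
    and to_complex_scaleR: "to_complex (scaleR r a) = scaleR r (to_complex a)"
    and norm_to_complex: "norm (to_complex a) = norm a"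
    and range_to_complex: "range to_complex = \<real> \<or> range to_complex = UNIV"

instantiation real :: real_or_complex
begin

definition to_complex_real :: "real \<Rightarrow> complex"
  where "to_complex_real = complex_of_real"

instance
proof
  show "range (to_complex :: real \<Rightarrow> complex) = \<real> \<or> range (to_complex :: real \<Rightarrow> complex) = UNIV"
    by (simp add: to_complex_real_def Reals_def)
qed (simp_all add: to_complex_real_def scaleR_conv_of_real)

end

instantiation complex :: real_or_complex
begin

definition to_complex_complex :: "complex \<Rightarrow> complex"
  where "to_complex_complex = (\<lambda>z. z)"

instance
  by standard (simp_all add: to_complex_complex_def)

end

(* By ip_commute, ip v v is real, so the condition on its real part is the usual
   positive definiteness; ip_commute also gives conjugate-linearity in the second argument. *)
locale inner_product_space = vector_space scale
  for scale :: "'k::real_or_complex \<Rightarrow> 'v::ab_group_add \<Rightarrow> 'v" +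
  fixes ip :: "'v \<Rightarrow> 'v \<Rightarrow> 'k"
  assumes ip_add_left: "ip (u + v) w = ip u w + ip v w"
    and ip_scale_left: "ip (scale a v) w = a * ip v w"
    and ip_commute: "to_complex (ip v w) = cnj (to_complex (ip w v))"
    and ip_pos: "v \<noteq> 0 \<Longrightarrow> 0 < Re (to_complex (ip v v))"

definition ip_norm :: "('v \<Rightarrow> 'v \<Rightarrow> 'k::real_or_complex) \<Rightarrow> 'v \<Rightarrow> real"
  where "ip_norm ip v = sqrt (Re (to_complex (ip v v)))"

lemma real_inner_product_space:
  "inner_product_space (scaleR :: real \<Rightarrow> 'a \<Rightarrow> 'a::real_inner) inner"
proof
  show "to_complex (v \<bullet> w) = cnj (to_complex (w \<bullet> v))" for v w :: 'a
    by (simp add: to_complex_real_def inner_commute[of v w])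
  show "0 < Re (to_complex (v \<bullet> v))" if "v \<noteq> 0" for v :: 'a
    using that by (simp add: to_complex_real_def)
qed (simp_all add: inner_add_left scaleR_add_right scaleR_add_left)

lemma ip_norm_inner: "ip_norm inner v = norm v"
  by (simp add: ip_norm_def to_complex_real_def norm_eq_sqrt_inner)

lemma complex_inner_product_space:
  "inner_product_space ((*) :: complex \<Rightarrow> complex \<Rightarrow> complex) (\<lambda>z w. z * cnj w)"
proof
  show "to_complex (v * cnj w) = cnj (to_complex (w * cnj v))" for v w :: complex
    by (simp add: to_complex_complex_def mult.commute)
  show "0 < Re (to_complex (v * cnj v))" if "v \<noteq> 0" for v :: complex
    using that unfolding to_complex_complex_def complex_mult_cnj
    by (simp add: complex_neq_0)
qed (simp_all add: distrib_left distrib_right mult.assoc)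

definition distinct_pairs :: "nat \<Rightarrow> (nat \<times> nat) set"
  where "distinct_pairs n = {(i, j). i \<in> {1..n} \<and> j \<in> {1..n} \<and> i \<noteq> j}"

(* Max {} is unspecified. *)
definition max_or_zero :: "real set \<Rightarrow> real"
  where "max_or_zero A = (if A = {} then 0 else Max A)"

end

theory Submission
  imports Defs
begin

text \<open>Choose scalars \<open>d\<^sub>i\<close> conjugate to the \<open>c\<^sub>i\<close> and put \<open>z = \<Sum> d\<^sub>i y\<^sub>i\<close>. Then
  \<open>(x, z) = \<Sum> c\<^sub>i (x, y\<^sub>i)\<close>, so that the Cauchy-Schwarz inequality bounds the left-hand side of all
  four inequalities by \<open>\<parallel>x\<parallel>\<^sup>2 \<parallel>z\<parallel>\<^sup>2\<close>. Expanding \<open>\<parallel>z\<parallel>\<^sup>2\<close> and separating the diagonal gives the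
  common bound of lemma \<open>norm_sum_ip_le\<close>:
  \<open>\<parallel>z\<parallel>\<^sup>2 \<le> \<Sum>\<^sub>i |c\<^sub>i|\<^sup>2 \<parallel>y\<^sub>i\<parallel>\<^sup>2 + \<Sum>\<^sub>i\<^sub>\<noteq>\<^sub>j |c\<^sub>i| |c\<^sub>j| |(y\<^sub>i, y\<^sub>j)|\<close>.

  What remains are inequalities between nonnegative reals. In each of the four cases both sums are
  estimated by a Hoelder inequality with the same factor in \<open>c\<close>. The pairing is that of \<open>l\<^sup>1\<close> and
  \<open>l\<^sup>\<infinity>\<close>, except in the off-diagonal sum of the first inequality (exponents 2 and 2) and in both
  sums of the third (exponents \<open>p\<close> and \<open>q\<close>). The powers of \<open>n - 1\<close> come from lemma
  \<open>sum_products_distinct_pairs_le\<close>, taken at \<open>|c\<^sub>i|\<close> for the fourth inequality and at \<open>|c\<^sub>i|\<^sup>p\<close> for the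
  third.\<close>

section \<open>Scalars\<close>

lemma to_complex_zero [simp]: "to_complex (0 :: 'k::real_or_complex) = 0"
  using norm_to_complex[of "0 :: 'k"] by simp

lemma to_complex_sum: "to_complex (\<Sum>i\<in>A. f i) = (\<Sum>i\<in>A. to_complex (f i))"
  by (induction A rule: infinite_finite_induct) (auto simp: to_complex_add)

text \<open>Both possible images of \<open>to_complex\<close>, the reals and the complex numbers, are closed under
  conjugation.\<close>
lemma conjugate_exists:
  fixes c :: "'k::real_or_complex"
  shows "\<exists>d :: 'k. to_complex d = cnj (to_complex c)"
proof -
  have "cnj (to_complex c) \<in> range (to_complex :: 'k \<Rightarrow> complex)"
  proof (cases "range (to_complex :: 'k \<Rightarrow> complex) = UNIV")
    case False
    then have R: "range (to_complex :: 'k \<Rightarrow> complex) = \<real>"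
      using range_to_complex by blast
    then have "to_complex c \<in> \<real>" by blast
    then show ?thesis by (simp add: R Reals_cnj_iff)
  qed simp
  then show ?thesis by (metis imageE)
qed

section \<open>Inner product spaces\<close>

context inner_product_space
begin

lemma ip_zero_left [simp]: "ip 0 w = 0"
  using ip_add_left[of 0 0 w] by simp

lemma ip_commute_zero: "ip v w = 0 \<Longrightarrow> ip w v = 0"
  by (metis ip_commute norm_to_complex norm_eq_zero complex_cnj_zero to_complex_zero)

lemma ip_zero_right [simp]: "ip v 0 = 0"
  by (rule ip_commute_zero) simp

lemma ip_diff_left: "ip (u - v) w = ip u w - ip v w"
  using ip_add_left[of "u - v" v w] by (simp add: algebra_simps)

lemma ip_sum_left: "ip (\<Sum>i\<in>A. f i) w = (\<Sum>i\<in>A. ip (f i) w)"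
  by (induction A rule: infinite_finite_induct) (auto simp: ip_add_left)

lemma ip_self_nonneg: "0 \<le> Re (to_complex (ip v v))"
  by (cases "v = 0") (auto simp: less_imp_le ip_pos)

lemma to_complex_ip_self: "to_complex (ip v v) = of_real ((ip_norm ip v)\<^sup>2)"
proof -
  have "to_complex (ip v v) \<in> \<real>"
    by (metis ip_commute Reals_cnj_iff)
  then show ?thesis
    by (simp add: ip_norm_def ip_self_nonneg)
qed

lemma norm_ip_self: "norm (ip v v) = (ip_norm ip v)\<^sup>2"
  by (metis norm_to_complex to_complex_ip_self norm_of_real abs_power2)

lemma to_complex_ip_sum_right:
  assumes d: "\<And>i. i \<in> A \<Longrightarrow> to_complex (d i) = cnj (to_complex (c i))"
  shows "to_complex (ip v (\<Sum>i\<in>A. scale (d i) (f i))) = to_complex (\<Sum>i\<in>A. c i * ip v (f i))"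
proof -
  have "to_complex (ip v (\<Sum>i\<in>A. scale (d i) (f i)))
      = cnj (\<Sum>i\<in>A. to_complex (d i) * to_complex (ip (f i) v))"
    by (subst ip_commute) (simp add: ip_sum_left ip_scale_left to_complex_sum to_complex_mult)
  also have "\<dots> = (\<Sum>i\<in>A. to_complex (c i) * to_complex (ip v (f i)))"
    by (auto simp: d ip_commute[symmetric] intro!: sum.cong)
  finally show ?thesis by (simp add: to_complex_sum to_complex_mult)
qed

lemma cauchy_schwarz: "(norm (ip v w))\<^sup>2 \<le> (ip_norm ip v)\<^sup>2 * (ip_norm ip w)\<^sup>2"
proof (cases "w = 0")
  case False
  define a where "a = ip v w / ip w w"
  \<comment> \<open>The component of \<open>v\<close> orthogonal to \<open>w\<close>; its square norm is nonnegative.\<close>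
  define u where "u = v - scale a w"
  have pos: "(ip_norm ip w)\<^sup>2 > 0"
    using ip_pos[OF False] by (simp add: to_complex_ip_self)
  then have "ip w w \<noteq> 0"
    using norm_ip_self[of w] by auto
  then have aw: "a * ip w w = ip v w"
    by (simp add: a_def)
  have "ip u w = 0"
    by (simp add: u_def ip_diff_left ip_scale_left aw)
  then have "ip w u = 0"
    by (rule ip_commute_zero)
  then have "ip u u = ip v u"
    by (metis u_def ip_diff_left ip_scale_left mult_zero_right diff_zero)
  then have "0 \<le> Re (to_complex (ip v u))"
    using ip_self_nonneg[of u] by simp
  also have "to_complex (ip v u) = cnj (to_complex (ip u v))"
    by (rule ip_commute)
  finally have nonneg: "0 \<le> Re (to_complex (ip u v))"
    by simp
  have "ip u v * ip w w + ip v w * ip w v = ip v v * ip w w"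
    by (simp add: u_def ip_diff_left ip_scale_left algebra_simps flip: aw)
  then have "to_complex (ip u v) * to_complex (ip w w) + to_complex (ip v w) * to_complex (ip w v)
      = to_complex (ip v v) * to_complex (ip w w)"
    by (metis to_complex_add to_complex_mult)
  moreover have "to_complex (ip v w) * to_complex (ip w v) = of_real ((norm (ip v w))\<^sup>2)"
    by (metis ip_commute complex_norm_square norm_to_complex)
  ultimately have "Re (to_complex (ip u v) * of_real ((ip_norm ip w)\<^sup>2) + of_real ((norm (ip v w))\<^sup>2))
      = Re (of_real ((ip_norm ip v)\<^sup>2) * of_real ((ip_norm ip w)\<^sup>2))"
    by (simp add: to_complex_ip_self)
  then have "Re (to_complex (ip u v)) * (ip_norm ip w)\<^sup>2 + (norm (ip v w))\<^sup>2
      = (ip_norm ip v)\<^sup>2 * (ip_norm ip w)\<^sup>2"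
    by (simp flip: of_real_power of_real_mult)
  moreover have "0 \<le> Re (to_complex (ip u v)) * (ip_norm ip w)\<^sup>2"
    using nonneg by simp
  ultimately show ?thesis by linarith
qed simp

end

section \<open>Sums over ordered pairs of distinct indices\<close>

lemma finite_distinct_pairs [simp]: "finite (distinct_pairs n)"
  by (rule finite_subset[of _ "{1..n} \<times> {1..n}"]) (auto simp: distinct_pairs_def)

lemma sum_split_diagonal:
  fixes f :: "nat \<Rightarrow> nat \<Rightarrow> 'a::comm_monoid_add"
  shows "(\<Sum>i=1..n. \<Sum>j=1..n. f i j) = (\<Sum>i=1..n. f i i) + (\<Sum>(i, j)\<in>distinct_pairs n. f i j)"
proof -
  let ?D = "(\<lambda>i. (i, i)) ` {1..n}"
  have "{1..n} \<times> {1..n} = ?D \<union> distinct_pairs n" "?D \<inter> distinct_pairs n = {}"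
    by (auto simp: distinct_pairs_def)
  then have "(\<Sum>i=1..n. \<Sum>j=1..n. f i j)
      = (\<Sum>(i, j)\<in>?D. f i j) + (\<Sum>(i, j)\<in>distinct_pairs n. f i j)"
    by (simp add: sum.cartesian_product sum.union_disjoint)
  also have "(\<Sum>(i, j)\<in>?D. f i j) = (\<Sum>i=1..n. f i i)"
    by (subst sum.reindex) (auto simp: inj_on_def)
  finally show ?thesis .
qed

text \<open>Bound each product by the mean of the two squares; every index occurs in \<open>n - 1\<close> of the pairs
  in either position.\<close>
lemma sum_products_distinct_pairs_le:
  fixes g :: "nat \<Rightarrow> real"
  shows "(\<Sum>(i, j)\<in>distinct_pairs n. g i * g j) \<le> (real n - 1) * (\<Sum>i=1..n. (g i)\<^sup>2)"
proof -
  let ?h = "\<lambda>i j. ((g i)\<^sup>2 + (g j)\<^sup>2) / 2"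
  have "(\<Sum>(i, j)\<in>distinct_pairs n. g i * g j) \<le> (\<Sum>(i, j)\<in>distinct_pairs n. ?h i j)"
  proof (rule sum_mono, clarify)
    fix i j
    have "0 \<le> (g i - g j)\<^sup>2" by simp
    then show "g i * g j \<le> ?h i j" by (simp add: power2_diff)
  qed
  also have "\<dots> = (\<Sum>i=1..n. \<Sum>j=1..n. ?h i j) - (\<Sum>i=1..n. (g i)\<^sup>2)"
    using sum_split_diagonal[of ?h n] by simp
  also have "(\<Sum>i=1..n. \<Sum>j=1..n. ?h i j) = real n * (\<Sum>i=1..n. (g i)\<^sup>2)"
    by (simp add: sum.distrib add_divide_distrib sum_distrib_left flip: sum_divide_distrib)
  finally show ?thesis by (simp add: algebra_simps)
qed

text \<open>The right-hand side is the same sum extended to all ordered pairs.\<close>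
lemma sum_products_distinct_pairs_le_square:
  fixes g :: "nat \<Rightarrow> real"
  shows "(\<Sum>(i, j)\<in>distinct_pairs n. (g i * g j)\<^sup>2) \<le> (\<Sum>i=1..n. (g i)\<^sup>2)\<^sup>2"
proof -
  have "(\<Sum>(i, j)\<in>distinct_pairs n. (g i * g j)\<^sup>2) \<le> (\<Sum>i=1..n. \<Sum>j=1..n. (g i * g j)\<^sup>2)"
    unfolding sum_split_diagonal by (simp add: sum_nonneg)
  also have "\<dots> = (\<Sum>i=1..n. (g i)\<^sup>2)\<^sup>2"
    by (simp add: power_mult_distrib power2_eq_square[of "sum _ _"] sum_product)
  finally show ?thesis .
qed

section \<open>The common bound\<close>

text \<open>The vector \<open>z = \<Sum> d\<^sub>i y\<^sub>i\<close> with \<open>d\<^sub>i\<close> conjugate to \<open>c\<^sub>i\<close> serves twice: pairing it with \<open>x\<close> gives the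
  sum to be bounded, and pairing it with itself and then with each \<open>y\<^sub>i\<close> expands its square norm.\<close>
lemma (in inner_product_space) norm_sum_ip_le:
  "(norm (\<Sum>i=1..n. c i * ip x (y i)))\<^sup>2
    \<le> (ip_norm ip x)\<^sup>2 * ((\<Sum>i=1..n. (norm (c i))\<^sup>2 * (ip_norm ip (y i))\<^sup>2)
        + (\<Sum>(i, j)\<in>distinct_pairs n. norm (c i) * norm (c j) * norm (ip (y i) (y j))))"
proof -
  have "\<exists>d :: nat \<Rightarrow> 'k. \<forall>i. to_complex (d i) = cnj (to_complex (c i))"
    by (intro choice allI conjugate_exists)
  then obtain d :: "nat \<Rightarrow> 'k" where d: "\<And>i. to_complex (d i) = cnj (to_complex (c i))"
    by blast
  have norm_d: "norm (d i) = norm (c i)" for i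
    using norm_to_complex[of "d i"] norm_to_complex[of "c i"] by (simp add: d)
  define z where "z = (\<Sum>i=1..n. scale (d i) (y i))"
  have ip_z: "norm (ip v z) = norm (\<Sum>i=1..n. c i * ip v (y i))" for v
  proof -
    have "to_complex (ip v z) = to_complex (\<Sum>i=1..n. c i * ip v (y i))"
      unfolding z_def by (rule to_complex_ip_sum_right) (rule d)
    from arg_cong[OF this, of norm] show ?thesis
      by (simp only: norm_to_complex)
  qed
  have "(ip_norm ip z)\<^sup>2 = norm (\<Sum>i=1..n. d i * ip (y i) z)"
    unfolding norm_ip_self[symmetric]
    by (subst z_def) (simp add: ip_sum_left ip_scale_left)
  also have "\<dots> \<le> (\<Sum>i=1..n. norm (c i) * norm (ip (y i) z))"
    by (rule order_trans[OF norm_sum]) (simp add: norm_mult norm_d)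
  also have "\<dots> \<le> (\<Sum>i=1..n. norm (c i) * (\<Sum>j=1..n. norm (c j) * norm (ip (y i) (y j))))"
    unfolding ip_z
    by (intro sum_mono mult_left_mono order_trans[OF norm_sum]) (simp_all add: norm_mult)
  also have "\<dots> = (\<Sum>i=1..n. \<Sum>j=1..n. norm (c i) * norm (c j) * norm (ip (y i) (y j)))"
    by (simp add: sum_distrib_left mult.assoc)
  also have "\<dots> = (\<Sum>i=1..n. (norm (c i))\<^sup>2 * (ip_norm ip (y i))\<^sup>2)
        + (\<Sum>(i, j)\<in>distinct_pairs n. norm (c i) * norm (c j) * norm (ip (y i) (y j)))"
    by (simp only: sum_split_diagonal norm_ip_self power2_eq_square[of "norm (c _)"])
  finally have z_le: "(ip_norm ip z)\<^sup>2 \<le> \<dots>" .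
  have "(norm (\<Sum>i=1..n. c i * ip x (y i)))\<^sup>2 \<le> (ip_norm ip x)\<^sup>2 * (ip_norm ip z)\<^sup>2"
    using cauchy_schwarz[of x z] by (simp add: ip_z)
  also note mult_left_mono[OF z_le zero_le_power2]
  finally show ?thesis .
qed

section \<open>Hoelder's inequality for finite sums\<close>

text \<open>If neither power sum is zero, dividing \<open>f\<close> and \<open>g\<close> by their \<open>l\<^sup>p\<close> and \<open>l\<^sup>q\<close> norms reduces the
  claim to Young's inequality for each summand, and the bounds add up to \<open>1 / p + 1 / q = 1\<close>.\<close>
lemma holder_inequality_sum:
  fixes f g :: "'a \<Rightarrow> real"
  assumes pq: "p > 1" "q > 1" "1 / p + 1 / q = 1"
    and f: "\<And>i. i \<in> A \<Longrightarrow> 0 \<le> f i" and g: "\<And>i. i \<in> A \<Longrightarrow> 0 \<le> g i"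
  shows "(\<Sum>i\<in>A. f i * g i)
    \<le> (\<Sum>i\<in>A. f i powr p) powr (1 / p) * (\<Sum>i\<in>A. g i powr q) powr (1 / q)"
proof (cases "finite A")
  case fin: True
  define F where "F = (\<Sum>i\<in>A. f i powr p)"
  define G where "G = (\<Sum>i\<in>A. g i powr q)"
  have FG: "0 \<le> F" "0 \<le> G"
    by (simp_all add: F_def G_def sum_nonneg)
  show ?thesis
  proof (cases "F = 0 \<or> G = 0")
    case True
    then have "\<forall>i\<in>A. f i * g i = 0"
      using fin by (auto simp: F_def G_def sum_nonneg_eq_0_iff)
    then have "(\<Sum>i\<in>A. f i * g i) = 0"
      by (intro sum.neutral)
    then show ?thesis by simp
  next
    case False
    define \<alpha> where "\<alpha> = F powr (1 / p)"
    define \<beta> where "\<beta> = G powr (1 / q)"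
    have pos: "\<alpha> > 0" "\<beta> > 0" "F > 0" "G > 0"
      using False FG by (simp_all add: \<alpha>_def \<beta>_def)
    have ab: "\<alpha> powr p = F" "\<beta> powr q = G"
      using pq pos by (simp_all add: \<alpha>_def \<beta>_def powr_powr)
    have "(\<Sum>i\<in>A. (f i / \<alpha>) * (g i / \<beta>)) \<le> (\<Sum>i\<in>A. (f i powr p / F) / p + (g i powr q / G) / q)"
    proof (rule sum_mono)
      fix i assume i: "i \<in> A"
      show "(f i / \<alpha>) * (g i / \<beta>) \<le> (f i powr p / F) / p + (g i powr q / G) / q"
        using Youngs_inequality[OF pq, of "f i / \<alpha>" "g i / \<beta>"] i f g pos
        by (simp add: powr_divide ab)
    qed
    also have "\<dots> = F / F / p + G / G / q"
      by (simp add: sum.distrib F_def G_def flip: sum_divide_distrib)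
    also have "\<dots> = 1"
      using pos pq by simp
    finally have "(\<Sum>i\<in>A. f i * g i) / (\<alpha> * \<beta>) \<le> 1"
      by (simp add: sum_divide_distrib)
    then show ?thesis
      using pos by (simp add: F_def[symmetric] G_def[symmetric] \<alpha>_def[symmetric] \<beta>_def[symmetric]
          divide_le_eq)
  qed
qed simp

section \<open>The four inequalities\<close>

theorem corollary3:
  fixes scale :: "'k::real_or_complex \<Rightarrow> 'v::ab_group_add \<Rightarrow> 'v"
    and ip :: "'v \<Rightarrow> 'v \<Rightarrow> 'k"
    and n :: nat and x :: 'v and y :: "nat \<Rightarrow> 'v" and c :: "nat \<Rightarrow> 'k"
  assumes "inner_product_space scale ip" and "n \<ge> 1"
  shows
    "(norm (\<Sum>i=1..n. c i * ip x (y i)))\<^sup>2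
       \<le> (ip_norm ip x)\<^sup>2 * (\<Sum>i=1..n. (norm (c i))\<^sup>2)
          * (Max ((\<lambda>i. (ip_norm ip (y i))\<^sup>2) ` {1..n})
             + sqrt (\<Sum>(i, j)\<in>distinct_pairs n. (norm (ip (y i) (y j)))\<^sup>2))
     \<and>
     (norm (\<Sum>i=1..n. c i * ip x (y i)))\<^sup>2
       \<le> (ip_norm ip x)\<^sup>2 * Max ((\<lambda>i. (norm (c i))\<^sup>2) ` {1..n})
          * ((\<Sum>i=1..n. (ip_norm ip (y i))\<^sup>2)
             + (\<Sum>(i, j)\<in>distinct_pairs n. norm (ip (y i) (y j))))
     \<and>
     (\<forall>p q :: real. p > 1 \<longrightarrow> 1 / p + 1 / q = 1 \<longrightarrow>
       (norm (\<Sum>i=1..n. c i * ip x (y i)))\<^sup>2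
         \<le> (ip_norm ip x)\<^sup>2 * (\<Sum>i=1..n. norm (c i) powr (2 * p)) powr (1 / p)
            * ((\<Sum>i=1..n. ip_norm ip (y i) powr (2 * q)) powr (1 / q)
               + (real n - 1) powr (1 / p)
                 * (\<Sum>(i, j)\<in>distinct_pairs n. norm (ip (y i) (y j)) powr q) powr (1 / q)))
     \<and>
     (norm (\<Sum>i=1..n. c i * ip x (y i)))\<^sup>2
       \<le> (ip_norm ip x)\<^sup>2 * (\<Sum>i=1..n. (norm (c i))\<^sup>2)
          * (Max ((\<lambda>i. (ip_norm ip (y i))\<^sup>2) ` {1..n})
             + (real n - 1)
               * max_or_zero ((\<lambda>(i, j). norm (ip (y i) (y j))) ` distinct_pairs n))"
proof -
  interpret inner_product_space scale ip by fact
  let ?L = "(norm (\<Sum>i=1..n. c i * ip x (y i)))\<^sup>2"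
  let ?N = "\<lambda>v. ip_norm ip v"
  let ?a = "\<lambda>i j. norm (ip (y i) (y j))"
  let ?P = "distinct_pairs n"
  have bound: "?L \<le> (?N x)\<^sup>2 * S * (D + E)"
    if "(\<Sum>i=1..n. (norm (c i))\<^sup>2 * (?N (y i))\<^sup>2) \<le> S * D"
      and "(\<Sum>(i, j)\<in>?P. norm (c i) * norm (c j) * ?a i j) \<le> S * E" for S D E
  proof -
    have "?L \<le> (?N x)\<^sup>2 * (S * D + S * E)"
      by (rule order_trans[OF norm_sum_ip_le mult_left_mono[OF add_mono[OF that]]]) simp
    then show ?thesis by (simp add: algebra_simps)
  qed
  define S where "S = (\<Sum>i=1..n. (norm (c i))\<^sup>2)"
  have S_nonneg: "0 \<le> S"
    by (simp add: S_def sum_nonneg)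
  have diag: "(\<Sum>i=1..n. (norm (c i))\<^sup>2 * (?N (y i))\<^sup>2) \<le> S * Max ((\<lambda>i. (?N (y i))\<^sup>2) ` {1..n})"
    unfolding S_def sum_distrib_right by (intro sum_mono mult_left_mono Max_ge) auto

  have "(\<Sum>(i, j)\<in>?P. norm (c i) * norm (c j) * ?a i j) \<le> S * sqrt (\<Sum>(i, j)\<in>?P. (?a i j)\<^sup>2)"
  proof -
    have "(\<Sum>(i, j)\<in>?P. norm (c i) * norm (c j) * ?a i j)\<^sup>2
        \<le> (\<Sum>(i, j)\<in>?P. (norm (c i) * norm (c j))\<^sup>2) * (\<Sum>(i, j)\<in>?P. (?a i j)\<^sup>2)"
      using Cauchy_Schwarz_ineq_sum[of "\<lambda>(i, j). norm (c i) * norm (c j)" "\<lambda>(i, j). ?a i j" ?P]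
      by (simp add: case_prod_unfold)
    also have "\<dots> \<le> S\<^sup>2 * (\<Sum>(i, j)\<in>?P. (?a i j)\<^sup>2)"
      unfolding S_def
      by (intro mult_right_mono sum_products_distinct_pairs_le_square sum_nonneg) auto
    finally have "(\<Sum>(i, j)\<in>?P. norm (c i) * norm (c j) * ?a i j)
        \<le> sqrt (S\<^sup>2 * (\<Sum>(i, j)\<in>?P. (?a i j)\<^sup>2))"
      by (rule real_le_rsqrt)
    then show ?thesis
      using S_nonneg by (simp add: real_sqrt_mult)
  qed
  note part1 = bound[OF diag this]

  define M where "M = Max ((\<lambda>i. (norm (c i))\<^sup>2) ` {1..n})"
  have M: "(norm (c i))\<^sup>2 \<le> M" if "i \<in> {1..n}" for i
    unfolding M_def using that by (intro Max_ge) auto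
  have MM: "norm (c i) * norm (c j) \<le> M" if "(i, j) \<in> ?P" for i j
  proof -
    have "0 \<le> (norm (c i) - norm (c j))\<^sup>2" by simp
    moreover have "(norm (c i))\<^sup>2 \<le> M" "(norm (c j))\<^sup>2 \<le> M"
      using that by (auto simp: distinct_pairs_def intro!: M)
    ultimately show ?thesis by (simp add: power2_diff)
  qed
  have part2: "?L \<le> (?N x)\<^sup>2 * M * ((\<Sum>i=1..n. (?N (y i))\<^sup>2) + (\<Sum>(i, j)\<in>?P. ?a i j))"
  proof (rule bound)
    show "(\<Sum>i=1..n. (norm (c i))\<^sup>2 * (?N (y i))\<^sup>2) \<le> M * (\<Sum>i=1..n. (?N (y i))\<^sup>2)"
      unfolding sum_distrib_left by (intro sum_mono mult_right_mono M) auto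
    show "(\<Sum>(i, j)\<in>?P. norm (c i) * norm (c j) * ?a i j) \<le> M * (\<Sum>(i, j)\<in>?P. ?a i j)"
      unfolding sum_distrib_left by (intro sum_mono) (auto intro!: mult_right_mono MM)
  qed

  have part3: "?L \<le> (?N x)\<^sup>2 * (\<Sum>i=1..n. norm (c i) powr (2 * p)) powr (1 / p)
      * ((\<Sum>i=1..n. ?N (y i) powr (2 * q)) powr (1 / q)
         + (real n - 1) powr (1 / p) * (\<Sum>(i, j)\<in>?P. ?a i j powr q) powr (1 / q))"
    if p: "p > 1" and pq: "1 / p + 1 / q = 1" for p q :: real
  proof (rule bound)
    have "0 < 1 / p" "1 / p < 1"
      using p by simp_all
    with pq have "1 / q > 0" "1 / q < 1"
      by linarith+
    then have q: "q > 1"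
      by (simp add: divide_less_eq zero_less_divide_iff)
    have square_powr: "(t\<^sup>2) powr r = t powr (2 * r)" if "0 \<le> t" for t r :: real
      using that by (cases "t = 0") (simp_all add: powr_powr flip: powr_numeral)
    have N_nonneg: "0 \<le> ?N v" for v
      by (simp add: ip_norm_def ip_self_nonneg)
    define T where "T = (\<Sum>i=1..n. norm (c i) powr (2 * p))"
    show "(\<Sum>i=1..n. (norm (c i))\<^sup>2 * (?N (y i))\<^sup>2)
        \<le> T powr (1 / p) * (\<Sum>i=1..n. ?N (y i) powr (2 * q)) powr (1 / q)"
      using holder_inequality_sum[OF p q pq, of "{1..n}" "\<lambda>i. (norm (c i))\<^sup>2" "\<lambda>i. (?N (y i))\<^sup>2"]
      by (simp add: T_def square_powr N_nonneg)
    define Q where "Q = (\<Sum>(i, j)\<in>?P. ?a i j powr q) powr (1 / q)"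
    have "(\<Sum>(i, j)\<in>?P. norm (c i) * norm (c j) * ?a i j)
        \<le> (\<Sum>(i, j)\<in>?P. (norm (c i) * norm (c j)) powr p) powr (1 / p) * Q"
      unfolding Q_def
      using holder_inequality_sum[OF p q pq, of ?P "\<lambda>(i, j). norm (c i) * norm (c j)" "\<lambda>(i, j). ?a i j"]
      by (simp add: case_prod_unfold)
    also have "\<dots> \<le> ((real n - 1) * T) powr (1 / p) * Q"
    proof -
      have "(\<Sum>(i, j)\<in>?P. (norm (c i) * norm (c j)) powr p) \<le> (real n - 1) * T"
        using sum_products_distinct_pairs_le[of "\<lambda>i. norm (c i) powr p" n]
        by (simp add: T_def powr_mult power2_eq_square flip: powr_add)
      then show ?thesis
        using p by (intro mult_right_mono powr_mono2) (auto simp: Q_def intro!: sum_nonneg)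
    qed
    also have "\<dots> = T powr (1 / p) * ((real n - 1) powr (1 / p) * Q)"
      using \<open>n \<ge> 1\<close> by (simp add: powr_mult T_def sum_nonneg)
    finally show "(\<Sum>(i, j)\<in>?P. norm (c i) * norm (c j) * ?a i j)
        \<le> T powr (1 / p) * ((real n - 1) powr (1 / p) * Q)" .
  qed

  define B where "B = max_or_zero ((\<lambda>(i, j). ?a i j) ` ?P)"
  have B: "?a i j \<le> B" if "(i, j) \<in> ?P" for i j
    unfolding B_def max_or_zero_def using that by (force intro!: Max_ge)
  \<comment> \<open>For \<open>n = 1\<close> there are no pairs, and \<open>B\<close> is nonnegative only because it is then read as 0.\<close>
  have B_nonneg: "0 \<le> B"
  proof (cases "?P = {}")
    case False
    then obtain i j where "(i, j) \<in> ?P" by auto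
    then show ?thesis using order_trans[OF norm_ge_zero B] by blast
  qed (simp add: B_def max_or_zero_def)
  have "(\<Sum>(i, j)\<in>?P. norm (c i) * norm (c j) * ?a i j) \<le> S * ((real n - 1) * B)"
  proof -
    have "(\<Sum>(i, j)\<in>?P. norm (c i) * norm (c j) * ?a i j)
        \<le> (\<Sum>(i, j)\<in>?P. norm (c i) * norm (c j)) * B"
      unfolding sum_distrib_right by (intro sum_mono) (auto intro!: mult_left_mono B)
    also have "\<dots> \<le> (real n - 1) * S * B"
      unfolding S_def by (intro mult_right_mono sum_products_distinct_pairs_le B_nonneg)
    finally show ?thesis by (simp add: algebra_simps)
  qed
  note part4 = bound[OF diag this]

  show ?thesis
    using part1 part2 part3 part4 unfolding S_def M_def B_def by blast
qed

end
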